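(* Let $G=(V,E)$ be a hypergraph with hyperedges $E=\{e_1,\dots,e_m\}$, and let $x=e_p$ be one of its hyperedges. Let $e_i'$ for $i\neq p$ denote the hyperedges after the symbolic elimination of $x$, and let $A_E'$ be the edge–edge adjacency matrix of the family $(e_i')_{i\ne p}$. Then the nonzero pattern of $A_E'$ is exactly the nonzero pattern obtained from the edge–edge adjacency matrix $A_E$ of $G$ by one step of symbolic Gaussian elimination with pivot $p$. That is, in terms of the edge–edge connectivity structure, symbolic edge elimination is equivalent to symbolic Gaussian elimination applied to the edge–edge adjacency matrix.
   Context: A hypergraph $G=(V,E)$ consists of a finite vertex set $V=\{v_1,\dots,v_n\}$ and hyperedges $e_1,\dots,e_m$, each a nonempty subset of $V$. Its node–edge incidence matrix $I_{VE}\in\mathbb{R}^{n\times m}$ has $(i,j)$ entry $1$ if $v_i\in e_j$ and $0$ otherwise. Its edge–edge adjacency matrix is $A_E=I_{VE}^T I_{VE}$. The same definitions apply to any indexed family of nonempty subsets of $V$, possibly with repetitions. Symbolic elimination of the hyperedge $x=e_p$ removes $x$ and replaces each remaining $e_i$ ($i\ne p$) by $e_i'=e_i\cup x$ if $e_i\cap x\neq\emptyset$, and by $e_i'=e_i$ otherwise. The family $(e_i')_{i\neq p}$ keeps the original indices, even if some sets coincide. One step of symbolic Gaussian elimination with pivot $p$ on a matrix $M$ with symmetric nonzero pattern produces the pattern on the indices $\{1,\dots,m\}\setminus\{p\}$ in which position $(i,j)$ is nonzero if and only if $M_{ij}\neq0$, or both $M_{ip}\neq0$ and $M_{pj}\neq0$.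 In other words, the pattern of the pivot row is merged into every row that has a nonzero in the pivot column, with no cancellation. *)

theory Defs
  imports Complex_Main
begin

text \<open>
  Matrices are functions of a row index and a column index, always read on explicit finite index
  sets. The number of hyperedges varies, and the matrices after an elimination are indexed by
  \<open>{1..m} - {p}\<close> with the original indices kept, so neither matrices over index types nor
  matrices over initial segments of the naturals fit directly.
\<close>

type_synonym rmatrix = "nat \<Rightarrow> nat \<Rightarrow> real"

definition mtranspose :: "rmatrix \<Rightarrow> rmatrix" where
  "mtranspose M = (\<lambda>i j. M j i)"

definition mprod :: "nat set \<Rightarrow> rmatrix \<Rightarrow> rmatrix \<Rightarrow> rmatrix" where
  "mprod K M N = (\<lambda>i j. \<Sum>k\<in>K. M i k * N k j)"

text \<open>
  The enumeration \<open>v\<close> lists the vertices without repetition; the members of the family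
  \<open>(e j)\<close>, \<open>j \<in> J\<close>, may coincide.
\<close>

locale hyperedge_family =
  fixes V :: "'v set" and n :: nat and v :: "nat \<Rightarrow> 'v"
    and J :: "nat set" and e :: "nat \<Rightarrow> 'v set"
  assumes vertices: "bij_betw v {1..n} V"
    and finite_index: "finite J"
    and edge_nonempty: "\<And>j. j \<in> J \<Longrightarrow> e j \<noteq> {}"
    and edge_subset: "\<And>j. j \<in> J \<Longrightarrow> e j \<subseteq> V"

locale hypergraph = hyperedge_family V n v "{1..m}" e
  for V :: "'v set" and n :: nat and v :: "nat \<Rightarrow> 'v"
    and m :: nat and e :: "nat \<Rightarrow> 'v set"

definition incidence_matrix :: "(nat \<Rightarrow> 'v) \<Rightarrow> (nat \<Rightarrow> 'v set) \<Rightarrow> rmatrix" where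
  "incidence_matrix v e = (\<lambda>i j. if v i \<in> e j then 1 else 0)"

definition edge_adjacency :: "nat \<Rightarrow> (nat \<Rightarrow> 'v) \<Rightarrow> (nat \<Rightarrow> 'v set) \<Rightarrow> rmatrix" where
  "edge_adjacency n v e =
     mprod {1..n} (mtranspose (incidence_matrix v e)) (incidence_matrix v e)"

text \<open>
  The value at \<open>p\<close> itself is irrelevant: the family after elimination is read on the index
  set without \<open>p\<close>.
\<close>

definition eliminate_edge :: "nat \<Rightarrow> (nat \<Rightarrow> 'v set) \<Rightarrow> nat \<Rightarrow> 'v set" where
  "eliminate_edge p e = (\<lambda>i. if e i \<inter> e p \<noteq> {} then e i \<union> e p else e i)"

definition nonzero_pattern :: "nat set \<Rightarrow> rmatrix \<Rightarrow> (nat \<times> nat) set" where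
  "nonzero_pattern J M = {(i, j). i \<in> J \<and> j \<in> J \<and> M i j \<noteq> 0}"

text \<open>Intended for matrices with symmetric nonzero pattern on \<open>J\<close>.\<close>

definition symbolic_gauss_step :: "nat set \<Rightarrow> nat \<Rightarrow> rmatrix \<Rightarrow> (nat \<times> nat) set" where
  "symbolic_gauss_step J p M =
     {(i, j). i \<in> J - {p} \<and> j \<in> J - {p} \<and> (M i j \<noteq> 0 \<or> (M i p \<noteq> 0 \<and> M p j \<noteq> 0))}"

lemma sym_edge_adjacency_pattern: "sym (nonzero_pattern J (edge_adjacency n v e))"
  by (auto simp: sym_def nonzero_pattern_def edge_adjacency_def mprod_def mtranspose_def
      mult.commute)

lemma (in hyperedge_family) hyperedge_family_eliminate_edge:
  assumes "p \<in> J"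
  shows "hyperedge_family V n v (J - {p}) (eliminate_edge p e)"
  using assms vertices finite_index edge_nonempty edge_subset
  by unfold_locales (auto simp: eliminate_edge_def split: if_splits)

end

theory Submission
  imports Defs
begin

text \<open>An entry of the adjacency matrix counts common vertices, so it is nonzero exactly when
  the two edges meet (\<open>edge_adjacency_nonzero_iff_meets\<close>). Both patterns thus become
  statements about intersections, and fill-in at (i, j) corresponds to \<open>e i\<close> and
  \<open>e j\<close> both meeting the pivot edge (\<open>eliminate_edge_meets_iff\<close>).\<close>

lemma edge_adjacency_nonzero_iff:
  "edge_adjacency n v e i j \<noteq> 0 \<longleftrightarrow> e i \<inter> e j \<inter> v ` {1..n} \<noteq> {}"
proof -
  let ?I = "incidence_matrix v e"
  have "edge_adjacency n v e i j = (\<Sum>k\<in>{1..n}. ?I k i * ?I k j)"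
    by (simp add: edge_adjacency_def mprod_def mtranspose_def)
  \<comment> \<open>All summands are 0 or 1, so nothing cancels.\<close>
  also have "\<dots> = 0 \<longleftrightarrow> (\<forall>k\<in>{1..n}. ?I k i * ?I k j = 0)"
    by (rule sum_nonneg_eq_0_iff) (auto simp: incidence_matrix_def)
  finally show ?thesis
    by (auto simp: incidence_matrix_def)
qed

text \<open>Since \<open>e i\<close> lies in V, so does the intersection; hence only the row index
  is constrained.\<close>

lemma (in hyperedge_family) edge_adjacency_nonzero_iff_meets:
  assumes "i \<in> J"
  shows "edge_adjacency n v e i j \<noteq> 0 \<longleftrightarrow> e i \<inter> e j \<noteq> {}"
proof -
  have "v ` {1..n} = V"
    using vertices by (rule bij_betw_imp_surj_on)
  then have "e i \<inter> e j \<inter> v ` {1..n} = e i \<inter> e j"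
    using edge_subset[OF assms] by blast
  then show ?thesis
    by (simp only: edge_adjacency_nonzero_iff)
qed

text \<open>If both edges meet \<open>e p\<close>, both absorb it and so share its vertices. If only
  one does, the vertices it gains miss the other edge, so the intersection is unchanged; if neither
  does, both edges stay as they are.\<close>

lemma eliminate_edge_meets_iff:
  assumes "e p \<noteq> {}"
  shows "eliminate_edge p e i \<inter> eliminate_edge p e j \<noteq> {} \<longleftrightarrow>
    e i \<inter> e j \<noteq> {} \<or> (e i \<inter> e p \<noteq> {} \<and> e p \<inter> e j \<noteq> {})"
  using assms unfolding eliminate_edge_def by auto

theorem mainTheorem3:
  fixes V :: "'v set" and n :: nat and v :: "nat \<Rightarrow> 'v"
    and m :: nat and e :: "nat \<Rightarrow> 'v set" and p :: nat
  assumes "hypergraph V n v m e"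
    and "p \<in> {1..m}"
  shows "nonzero_pattern ({1..m} - {p}) (edge_adjacency n v (eliminate_edge p e))
       = symbolic_gauss_step {1..m} p (edge_adjacency n v e)"
proof -
  interpret hypergraph V n v m e by fact
  interpret eliminated: hyperedge_family V n v "{1..m} - {p}" "eliminate_edge p e"
    using assms(2) by (rule hyperedge_family_eliminate_edge)
  have "edge_adjacency n v (eliminate_edge p e) i j \<noteq> 0 \<longleftrightarrow>
      edge_adjacency n v e i j \<noteq> 0 \<or>
      (edge_adjacency n v e i p \<noteq> 0 \<and> edge_adjacency n v e p j \<noteq> 0)"
    if "i \<in> {1..m} - {p}" for i j
    \<comment> \<open>The criterion is applied by rows: row i after elimination, then rows i and p
      of the original matrix.\<close>
    unfolding eliminated.edge_adjacency_nonzero_iff_meets[OF that]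
      edge_adjacency_nonzero_iff_meets[OF DiffD1[OF that]]
      edge_adjacency_nonzero_iff_meets[OF assms(2)]
    by (rule eliminate_edge_meets_iff[of e, OF edge_nonempty[OF assms(2)]])
  then show ?thesis
    unfolding nonzero_pattern_def symbolic_gauss_step_def by blast
qed

end
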